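(* Let $n\ge2$ and let $K,K'\subseteq\mathbb{R}^n$ be convex sets with nonempty interior, each either open or closed (bounded or not). A map $f\colon K\to K'$ is an isomorphism of $\mathcal{L}_{\mathrm{B}}$-structures if and only if $f$ is the restriction of a projective transformation $T\in\mathrm{PGL}_{n+1}(\mathbb{R})$ whose singular hyperplane is disjoint from $K$ and which satisfies $T(K)=K'$. In particular, $K$ and $K'$ are isomorphic as $\mathcal{L}_{\mathrm{B}}$-structures if and only if there is $T\in\mathrm{PGL}_{n+1}(\mathbb{R})$ with singular hyperplane disjoint from $K$ and $T(K)=K'$.
   Context: $\mathcal{L}_{\mathrm{B}}$ is the first-order language with a single ternary relation symbol $B$. A convex set $K\subseteq\mathbb{R}^n$ is regarded as an $\mathcal{L}_{\mathrm{B}}$-structure with universe $K$, where $B(a,x,b)$ holds iff $x\in[a,b]$ (the closed segment). $\mathbb{R}^n$ is embedded in $\mathbb{RP}^n$ as the standard affine chart; the singular hyperplane of $T\in\mathrm{PGL}_{n+1}(\mathbb{R})$ is the preimage under $T$ of the hyperplane at infinity. *)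

theory Defs
  imports "HOL-Analysis.Analysis"
begin

section \<open>Structures for the language with one ternary relation symbol\<close>

record 'a LB_structure =
  universe :: "'a set"
  Bet :: "'a \<Rightarrow> 'a \<Rightarrow> 'a \<Rightarrow> bool"

definition LB_iso :: "('a \<Rightarrow> 'b) \<Rightarrow> 'a LB_structure \<Rightarrow> 'b LB_structure \<Rightarrow> bool" where
  "LB_iso f M N \<longleftrightarrow>
     bij_betw f (universe M) (universe N) \<and>
     (\<forall>a\<in>universe M. \<forall>x\<in>universe M. \<forall>b\<in>universe M.
        Bet M a x b \<longleftrightarrow> Bet N (f a) (f x) (f b))"

definition LB_isomorphic :: "'a LB_structure \<Rightarrow> 'b LB_structure \<Rightarrow> bool" where
  "LB_isomorphic M N \<longleftrightarrow> (\<exists>f. LB_iso f M N)"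

definition segment_structure :: "(real^'n) set \<Rightarrow> (real^'n) LB_structure" where
  "segment_structure K = \<lparr>universe = K, Bet = (\<lambda>a x b. x \<in> closed_segment a b)\<rparr>"


section \<open>Real projective space and projective transformations\<close>

text \<open>Homogeneous coordinates on the projective space of dimension \<open>CARD('n)\<close> are indexed by
  \<^typ>\<open>'n option\<close>, which has one element more than \<^typ>\<open>'n\<close>; \<^const>\<open>None\<close> is the
  index of the homogenizing coordinate. Points are lines through the origin.\<close>

definition projective_space :: "(real^('n::finite option)) set set" where
  "projective_space = {L. subspace L \<and> dim L = 1}"

definition homogenize :: "real^('n::finite) \<Rightarrow> real^('n option)" where
  "homogenize x = (\<chi> i. case i of None \<Rightarrow> 1 | Some j \<Rightarrow> x $ j)"

definition affine_chart :: "real^('n::finite) \<Rightarrow> (real^'n option) set" where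
  "affine_chart x = span {homogenize x}"

definition hyperplane_at_infinity :: "(real^('n::finite option)) set set" where
  "hyperplane_at_infinity = {L \<in> projective_space. \<forall>v\<in>L. v $ None = 0}"

definition scalar_multiple_rel :: "((real^'m^'m) \<times> (real^'m^'m)) set" where
  "scalar_multiple_rel =
     {(A, B). invertible A \<and> invertible B \<and> (\<exists>c. c \<noteq> 0 \<and> B = c *\<^sub>R A)}"

text \<open>For \<^typ>\<open>'m\<close> of cardinality \<open>m\<close> this is \<open>PGL\<^sub>m(\<real>)\<close>: invertible matrices
  modulo nonzero scalars.\<close>

definition PGL :: "(real^'m^'m) set set" where
  "PGL = {A. invertible A} // scalar_multiple_rel"

text \<open>All matrices in a class map a line through the origin to the same line, so the union over
  the class is the image under any representative; see \<open>PGL_action_class\<close>.\<close>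

definition PGL_action :: "(real^'m^'m) set \<Rightarrow> (real^'m) set \<Rightarrow> (real^'m) set" where
  "PGL_action T L = (\<Union>A\<in>T. (*v) A ` L)"

definition singular_hyperplane :: "(real^('n::finite option)^('n option)) set \<Rightarrow> (real^'n option) set set" where
  "singular_hyperplane T = {L \<in> projective_space. PGL_action T L \<in> hyperplane_at_infinity}"

lemma affine_chart_in_projective_space: "affine_chart x \<in> projective_space"
proof -
  have "homogenize x $ None \<noteq> 0" by (simp add: homogenize_def)
  then have "homogenize x \<noteq> 0" by (metis zero_index)
  then show ?thesis
    by (simp add: projective_space_def affine_chart_def)
qed

lemma inj_affine_chart: "inj affine_chart"
proof (rule injI)
  fix x y :: "real^'n"
  assume "affine_chart x = affine_chart y"
  then have "homogenize x \<in> span {homogenize y}"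
    unfolding affine_chart_def by (metis span_base singletonI)
  then obtain c where c: "homogenize x = c *\<^sub>R homogenize y" by (auto simp: span_singleton)
  from arg_cong[OF c, of "\<lambda>v. v $ None"] have "c = 1" by (simp add: homogenize_def)
  with c have "homogenize x $ Some j = homogenize y $ Some j" for j by simp
  then show "x = y" by (simp add: homogenize_def vec_eq_iff)
qed

lemma equiv_scalar_multiple_rel:
  "equiv {A :: real^'m^'m. invertible A} scalar_multiple_rel" (is "equiv _ ?R")
proof (rule equivI)
  show "?R \<subseteq> {A. invertible A} \<times> {A. invertible A}"
    by (auto simp: scalar_multiple_rel_def)
  show "refl_on {A. invertible A} ?R"
    by (auto simp: refl_on_def scalar_multiple_rel_def intro!: exI[of _ 1])
  show "sym ?R"
  proof (rule symI)
    fix A B :: "real^'m^'m" assume "(A, B) \<in> scalar_multiple_rel"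
    then obtain c where "invertible A" "invertible B" "c \<noteq> 0" "B = c *\<^sub>R A"
      by (auto simp: scalar_multiple_rel_def)
    then have "inverse c \<noteq> 0" "A = inverse c *\<^sub>R B" by simp_all
    with \<open>invertible A\<close> \<open>invertible B\<close> show "(B, A) \<in> scalar_multiple_rel"
      unfolding scalar_multiple_rel_def by blast
  qed
  show "trans ?R"
  proof (rule transI)
    fix A B C :: "real^'m^'m"
    assume "(A, B) \<in> scalar_multiple_rel" "(B, C) \<in> scalar_multiple_rel"
    then obtain c d where "invertible A" "invertible C" "c \<noteq> 0" "d \<noteq> 0" "C = (d * c) *\<^sub>R A"
      by (auto simp: scalar_multiple_rel_def)
    then show "(A, C) \<in> scalar_multiple_rel"
      unfolding scalar_multiple_rel_def by (metis (mono_tags, lifting) case_prodI mem_Collect_eq no_zero_divisors)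
  qed
qed

lemma PGL_action_class:
  assumes "invertible A" and "subspace L"
  shows "PGL_action (scalar_multiple_rel `` {A}) L = (*v) A ` L"
proof
  show "PGL_action (scalar_multiple_rel `` {A}) L \<subseteq> (*v) A ` L"
  proof
    fix w assume "w \<in> PGL_action (scalar_multiple_rel `` {A}) L"
    then obtain c v where "v \<in> L" "w = (c *\<^sub>R A) *v v"
      by (auto simp: PGL_action_def scalar_multiple_rel_def)
    then have "w = A *v (c *\<^sub>R v)" "c *\<^sub>R v \<in> L"
      using \<open>subspace L\<close>
      by (simp_all add: scaleR_matrix_vector_assoc[symmetric] matrix_vector_mult_scaleR subspace_scale)
    then show "w \<in> (*v) A ` L" by blast
  qed
  have "(A, A) \<in> scalar_multiple_rel"
    using assms by (auto simp: scalar_multiple_rel_def intro!: exI[of _ 1])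
  then show "(*v) A ` L \<subseteq> PGL_action (scalar_multiple_rel `` {A}) L"
    by (auto simp: PGL_action_def)
qed

end

theory Submission
  imports Defs
begin

text \<open>Fix a simplex with vertices in \<open>K\<close>. An isomorphism \<open>f\<close> carries the faces of this simplex to
  the faces of the simplex spanned by the images of its vertices, so after composing with the
  projective map matching the vertices and the barycentre, \<open>f\<close> becomes a self-map of a simplex that
  fixes these points. In homogeneous barycentric coordinates such a map acts on each ratio of two
  coordinates by one and the same increasing multiplicative function \<open>\<phi>\<close> (this is where three
  vertices are needed), and the intersection of a median with a line joining two edge midpoints gives
  \<open>\<phi> 2 = 2\<close>. Hence \<open>\<phi>\<close> is the identity and \<open>f\<close> is projective on the simplex. Any other point
  \<open>x\<close> of \<open>K\<close> lies on several lines that meet the simplex in segments, which determines \<open>f x\<close>, also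
  on the boundary of \<open>K\<close>, and shows that \<open>x\<close> is not on the singular hyperplane.\<close>

section \<open>Self-maps of a simplex fixing the vertices and the barycentre\<close>

text \<open>The function agrees with the identity on integer powers of 2, and \<open>r ^ n\<close>
  lies between two consecutive ones. Hence \<open>log 2 (\<phi> r)\<close> and
  \<open>log 2 r\<close> differ by at most \<open>1 / n\<close> for every positive
  \<open>n\<close>.\<close>

lemma mono_mult_fixing_two:
  fixes \<phi> :: "real \<Rightarrow> real"
  assumes mult: "\<And>r s. r > 0 \<Longrightarrow> s > 0 \<Longrightarrow> \<phi> (r * s) = \<phi> r * \<phi> s"
    and mono: "\<And>r s. 0 < r \<Longrightarrow> r \<le> s \<Longrightarrow> \<phi> r \<le> \<phi> s"
    and pos: "\<And>r. r > 0 \<Longrightarrow> \<phi> r > 0"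
    and two: "\<phi> 2 = 2" and r: "r > 0"
  shows "\<phi> r = r"
proof -
  have one: "\<phi> 1 = 1"
    using mult[of 1 1] pos[of 1] by simp
  have pow: "\<phi> (s ^ n) = \<phi> s ^ n" if "s > 0" for s n
    using that by (induction n) (simp_all add: one mult)
  have half: "\<phi> (1/2) = 1/2"
    using mult[of 2 "1/2"] one two by simp
  have powi: "\<phi> (2 powi k) = 2 powi k" for k
    using pow[of 2 "nat k"] pow[of "1/2" "nat (- k)"] two half
    by (cases "k \<ge> 0") (simp_all add: power_int_def power_one_over inverse_eq_divide)
  have powr: "\<phi> (2 powr of_int k) = 2 powr of_int k" for k
    using powi[of k] by (simp add: powr_real_of_int')
  have near: "\<bar>log 2 (\<phi> r) - log 2 r\<bar> * real n \<le> 1" for n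
  proof -
    define k where "k = \<lfloor>real n * log 2 r\<rfloor>"
    have rn: "r ^ n = 2 powr (real n * log 2 r)"
      using r powr_power[where z = "2::real" and n = n and u = "log 2 r"] by simp
    have fn: "\<phi> r ^ n = 2 powr (real n * log 2 (\<phi> r))"
      using pos[OF r] powr_power[where z = "2::real" and n = n and u = "log 2 (\<phi> r)"] by simp
    have "2 powr of_int k \<le> r ^ n" "r ^ n \<le> 2 powr of_int (k + 1)"
      unfolding rn k_def by (auto intro!: powr_mono)
    then have "\<phi> (2 powr of_int k) \<le> \<phi> (r ^ n)" "\<phi> (r ^ n) \<le> \<phi> (2 powr of_int (k + 1))"
      using r by (auto intro!: mono)
    then have "2 powr of_int k \<le> \<phi> r ^ n" "\<phi> r ^ n \<le> 2 powr of_int (k + 1)"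
      by (simp_all only: powr pow[OF r])
    then have "of_int k \<le> real n * log 2 (\<phi> r)" "real n * log 2 (\<phi> r) \<le> of_int (k + 1)"
      unfolding fn by simp_all
    moreover have "of_int k \<le> real n * log 2 r" "real n * log 2 r \<le> of_int (k + 1)"
      unfolding k_def by linarith+
    ultimately have "\<bar>real n * log 2 (\<phi> r) - real n * log 2 r\<bar> \<le> 1"
      by simp
    then show ?thesis
      by (simp add: abs_mult flip: right_diff_distrib) (simp add: mult.commute)
  qed
  have "\<bar>log 2 (\<phi> r) - log 2 r\<bar> = 0"
  proof (rule ccontr)
    assume "\<bar>log 2 (\<phi> r) - log 2 r\<bar> \<noteq> 0"
    then obtain n where "1 < real n * \<bar>log 2 (\<phi> r) - log 2 r\<bar>"
      using ex_less_of_nat_mult[of "\<bar>log 2 (\<phi> r) - log 2 r\<bar>" 1] by auto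
    with near[of n] show False by (simp add: mult.commute)
  qed
  then have "2 powr log 2 (\<phi> r) = 2 powr log 2 r" by simp
  then show ?thesis using pos[OF r] r by simp
qed

section \<open>Maps of the nonnegative cone that preserve segments and faces\<close>

text \<open>Homogeneous barycentric coordinates of the points of a simplex; the zero vector
  represents no point.\<close>

definition nonneg_cone :: "(real^'m) set" where
  "nonneg_cone = {w. (\<forall>i. 0 \<le> w $ i) \<and> w \<noteq> 0}"

lemma nonneg_cone_add: "u \<in> nonneg_cone \<Longrightarrow> v \<in> nonneg_cone \<Longrightarrow> u + v \<in> nonneg_cone"
  unfolding nonneg_cone_def vec_eq_iff mem_Collect_eq plus_vec_def vec_lambda_beta zero_vec_def
  by (metis add_nonneg_eq_0_iff add_nonneg_nonneg)

lemma nonneg_cone_scaleR: "u \<in> nonneg_cone \<Longrightarrow> c > 0 \<Longrightarrow> c *\<^sub>R u \<in> nonneg_cone"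
  by (auto simp: nonneg_cone_def)

lemma nonneg_coneI: "(\<And>i. 0 \<le> w $ i) \<Longrightarrow> w $ k \<noteq> 0 \<Longrightarrow> w \<in> nonneg_cone"
  by (auto simp: nonneg_cone_def)

lemma one_in_nonneg_cone: "1 \<in> nonneg_cone"
  by (rule nonneg_coneI) auto

text \<open>A self-map of a simplex in homogeneous coordinates, constant on rays rather than
  homogeneous. \<open>add\<close> encodes that segments go to segments, \<open>supp\<close> that
  faces are preserved, and \<open>one\<close> that the barycentre is fixed.\<close>

locale cone_map =
  fixes F :: "real^'m \<Rightarrow> real^'m"
  assumes card3: "3 \<le> CARD('m)"
    and scale: "\<And>w c. w \<in> nonneg_cone \<Longrightarrow> c > 0 \<Longrightarrow> F (c *\<^sub>R w) = F w"
    and add: "\<And>u v. u \<in> nonneg_cone \<Longrightarrow> v \<in> nonneg_cone \<Longrightarrow>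
                \<exists>a b. 0 \<le> a \<and> 0 \<le> b \<and> F (u + v) = a *\<^sub>R F u + b *\<^sub>R F v"
    and nonneg: "\<And>w i. w \<in> nonneg_cone \<Longrightarrow> 0 \<le> F w $ i"
    and supp: "\<And>w i. w \<in> nonneg_cone \<Longrightarrow> F w $ i = 0 \<longleftrightarrow> w $ i = 0"
    and one: "\<And>i j. F 1 $ i = F 1 $ j"
begin

definition ratio :: "'m \<Rightarrow> 'm \<Rightarrow> real \<Rightarrow> real" where
  "ratio i j r = F (axis i 1 + r *\<^sub>R axis j 1) $ j / F (axis i 1 + r *\<^sub>R axis j 1) $ i"

lemma pos: "w \<in> nonneg_cone \<Longrightarrow> 0 < w $ i \<Longrightarrow> 0 < F w $ i"
  using nonneg[of w i] supp[of w i] by force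

lemma edge_in_cone: "0 \<le> r \<Longrightarrow> axis i 1 + r *\<^sub>R axis j 1 \<in> (nonneg_cone :: (real^'m) set)"
  by (rule nonneg_coneI[where k = i]) (auto simp: axis_def)

text \<open>Splitting \<open>w\<close> into its part on the edge \<open>{i, j}\<close> and a remainder supported off that edge shows
  that the ratio of two coordinates of \<open>F w\<close> depends only on the same two coordinates of \<open>w\<close>.\<close>

lemma ratio:
  assumes w: "w \<in> nonneg_cone" and i: "0 < w $ i" and j: "0 < w $ j" and ij: "i \<noteq> j"
  shows "F w $ j = ratio i j (w $ j / w $ i) * F w $ i"
proof -
  define z where "z = axis i 1 + (w $ j / w $ i) *\<^sub>R axis j (1::real)"
  define v where "v = w - w $ i *\<^sub>R z"
  have z: "z \<in> nonneg_cone"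
    unfolding z_def using i j by (intro edge_in_cone) simp
  have zi: "0 < F z $ i"
    using pos[OF z, of i] ij by (simp add: z_def axis_def)
  have v0: "v $ i = 0" "v $ j = 0"
    using ij i by (auto simp: v_def z_def axis_def)
  have vk: "v $ k = w $ k" if "k \<noteq> i" "k \<noteq> j" for k
    using that by (auto simp: v_def z_def axis_def)
  have wv: "w = w $ i *\<^sub>R z + v"
    by (simp add: v_def)
  have "\<exists>a. F w $ i = a * F z $ i \<and> F w $ j = a * F z $ j"
  proof (cases "v = 0")
    case True
    then have "F w = F z"
      using scale[OF z i] wv by simp
    then show ?thesis by (intro exI[of _ 1]) simp
  next
    case False
    have "0 \<le> v $ k" for k
      using v0 vk[of k] w by (cases "k = i \<or> k = j") (auto simp: nonneg_cone_def)
    with False have v: "v \<in> nonneg_cone" by (auto simp: nonneg_cone_def)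
    obtain a b where "F (w $ i *\<^sub>R z + v) = a *\<^sub>R F (w $ i *\<^sub>R z) + b *\<^sub>R F v"
      using add[OF nonneg_cone_scaleR[OF z i] v] by blast
    then have "F w = a *\<^sub>R F z + b *\<^sub>R F v"
      using scale[OF z i] wv by simp
    moreover have "F v $ i = 0" "F v $ j = 0"
      using supp[OF v] v0 by auto
    ultimately show ?thesis by auto
  qed
  then show ?thesis
    using zi by (auto simp: ratio_def z_def[symmetric])
qed

lemma ratio_one: "i \<noteq> j \<Longrightarrow> ratio i j 1 = 1"
  using ratio[OF one_in_nonneg_cone, of i j] one[of i j] pos[OF one_in_nonneg_cone, of i] by simp

lemma ratio_pos:
  assumes "i \<noteq> j" "0 < r"
  shows "0 < ratio i j r"
proof -
  have "0 < F (axis i 1 + r *\<^sub>R axis j 1) $ k" if "k = i \<or> k = j" for k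
    using assms that edge_in_cone[of r i j] by (intro pos) (auto simp: axis_def)
  then show ?thesis by (simp add: ratio_def)
qed

text \<open>All three values are coordinate ratios of one image point: the image of the point with
  coordinates \<open>1\<close>, \<open>r\<close>, \<open>r * s\<close> at \<open>i\<close>,
  \<open>j\<close>, \<open>k\<close>.\<close>

lemma ratio_mult:
  assumes d: "i \<noteq> j" "j \<noteq> k" "i \<noteq> k" and r: "0 < r" and s: "0 < s"
  shows "ratio i k (r * s) = ratio i j r * ratio j k s"
proof -
  define w where "w = axis i 1 + r *\<^sub>R axis j 1 + (r * s) *\<^sub>R axis k (1::real)"
  have w: "w \<in> nonneg_cone"
    using d r s by (intro nonneg_coneI[where k = i]) (auto simp: w_def axis_def)
  have v: "w $ i = 1" "w $ j = r" "w $ k = r * s"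
    using d by (auto simp: w_def axis_def)
  have "F w $ j = ratio i j r * F w $ i" "F w $ k = ratio j k s * F w $ j"
    "F w $ k = ratio i k (r * s) * F w $ i" "0 < F w $ i"
    using ratio[OF w, of i j] ratio[OF w, of j k] ratio[OF w, of i k] pos[OF w, of i] d v r s
    by simp_all
  then show ?thesis by simp
qed

lemma third_index:
  obtains k :: 'm where "k \<noteq> i" "k \<noteq> j"
proof -
  have "card {i, j} < CARD('m)"
    using card3 by (simp add: card_insert_if)
  then have "{i, j} \<noteq> UNIV" by (metis less_irrefl)
  then show ?thesis using that by blast
qed

text \<open>The midpoints of the edges \<open>{j, i}\<close> and \<open>{j, k}\<close> are fixed, hence so is the intersection of
  the line joining them with the median through vertex \<open>j\<close>; its coordinates there are \<open>(1, 2, 1)\<close>.\<close>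

lemma ratio_two:
  assumes ij: "i \<noteq> j"
  shows "ratio i j 2 = 2"
proof -
  obtain k where k: "k \<noteq> i" "k \<noteq> j" by (rule third_index)
  define u where "u = axis j 1 + 1 *\<^sub>R axis i (1::real)"
  define v where "v = axis j 1 + 1 *\<^sub>R axis k (1::real)"
  have u: "u \<in> nonneg_cone" and v: "v \<in> nonneg_cone"
    unfolding u_def v_def by (rule edge_in_cone; simp)+
  have c: "u $ i = 1" "u $ j = 1" "u $ k = 0" "v $ i = 0" "v $ j = 1" "v $ k = 1"
    using ij k by (auto simp: u_def v_def axis_def)
  obtain a b where ab: "F (u + v) = a *\<^sub>R F u + b *\<^sub>R F v"
    using add[OF u v] by blast
  have 1: "F u $ j = F u $ i" "F v $ j = F v $ k"
    using ratio[OF u, of i j] ratio[OF v, of k j] c ij k by (simp_all add: ratio_one)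
  have 2: "F (u + v) $ k = F (u + v) $ i"
    using ratio[OF nonneg_cone_add[OF u v], of i k] c k by (simp add: ratio_one)
  have 3: "F (u + v) $ j = ratio i j 2 * F (u + v) $ i"
    using ratio[OF nonneg_cone_add[OF u v], of i j] c ij by simp
  have "F u $ k = 0" "F v $ i = 0"
    using supp[OF u] supp[OF v] c by auto
  then have "F (u + v) $ j = 2 * F (u + v) $ i"
    using 1 2 by (simp add: ab)
  moreover have "0 < F (u + v) $ i"
    using c by (intro pos nonneg_cone_add u v) simp
  ultimately show ?thesis using 3 by simp
qed

text \<open>The edge point of ratio \<open>r\<close> lies between vertex \<open>i\<close> and the
  edge point of ratio \<open>s\<close>. In the image, the share of vertex \<open>i\<close> can only
  enlarge coordinate \<open>i\<close>, so the quotient does not grow.\<close>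

lemma ratio_mono:
  assumes ij: "i \<noteq> j" and r: "0 < r" "r \<le> s"
  shows "ratio i j r \<le> ratio i j s"
proof (cases "r = s")
  case False
  define u where "u = axis i 1 + s *\<^sub>R axis j (1::real)"
  define e where "e = axis i (1::real)"
  have u: "u \<in> nonneg_cone" unfolding u_def using r by (intro edge_in_cone) simp
  have e: "e \<in> nonneg_cone" by (rule nonneg_coneI[where k = i]) (auto simp: e_def axis_def)
  \<comment> \<open>The weights give \<open>w\<close> the coordinates 1 at \<open>i\<close> and
    \<open>r\<close> at \<open>j\<close>.\<close>
  define w where "w = (r / s) *\<^sub>R u + (1 - r / s) *\<^sub>R e"
  have p: "0 < r / s" "0 < 1 - r / s" using r False by auto
  have w: "w \<in> nonneg_cone"
    unfolding w_def by (intro nonneg_cone_add nonneg_cone_scaleR u e p)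
  have c: "w $ i = 1" "w $ j = r" "u $ i = 1" "u $ j = s" "e $ i = 1" "e $ j = 0"
    using ij r by (auto simp: w_def u_def e_def axis_def)
  obtain a b where ab: "0 \<le> a" "0 \<le> b" "F w = a *\<^sub>R F u + b *\<^sub>R F e"
    unfolding w_def using add[OF nonneg_cone_scaleR[OF u p(1)] nonneg_cone_scaleR[OF e p(2)]]
      scale[OF u p(1)] scale[OF e p(2)] by auto
  have f: "F e $ j = 0" using supp[OF e] c by auto
  have 1: "F w $ j = ratio i j r * F w $ i" "F u $ j = ratio i j s * F u $ i"
    using ratio[OF w, of i j] ratio[OF u, of i j] c ij r by simp_all
  have "F w $ j = ratio i j s * (a * F u $ i)"
    using f 1(2) unfolding ab(3) by simp
  also have "\<dots> \<le> ratio i j s * F w $ i"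
    using ratio_pos[OF ij, of s] r ab nonneg[OF e, of i] by (intro mult_left_mono) auto
  finally show ?thesis using 1 pos[OF w, of i] c by simp
qed simp

text \<open>\<open>ratio_mult\<close> links three index pairs. Setting one of its arguments to 1
  shows that the functions for \<open>(i, k)\<close>, \<open>(k, j)\<close> and
  \<open>(i, j)\<close> coincide, which turns it into multiplicativity of a single function.\<close>

lemma ratio_eq:
  assumes ij: "i \<noteq> j" and r: "0 < r"
  shows "ratio i j r = r"
proof (rule mono_mult_fixing_two[where \<phi> = "ratio i j", OF _ ratio_mono[OF ij] ratio_pos[OF ij] ratio_two[OF ij] r])
  obtain k where k: "k \<noteq> i" "k \<noteq> j" by (rule third_index)
  fix r s :: real assume rs: "0 < r" "0 < s"
  have "ratio i j r = ratio i k r" "ratio i j s = ratio k j s"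
    using ratio_mult[of i k j r 1] ratio_mult[of i k j 1 s] ij k rs by (simp_all add: ratio_one)
  then show "ratio i j (r * s) = ratio i j r * ratio i j s"
    using ratio_mult[of i k j r s] ij k rs by simp
qed

lemma proportional:
  assumes w: "w \<in> nonneg_cone"
  shows "\<exists>c. F w = c *\<^sub>R w"
proof -
  have w0: "w $ j = 0 \<or> 0 < w $ j" for j
    using w by (auto simp: nonneg_cone_def order_le_less)
  moreover have "w \<noteq> 0" using w by (simp add: nonneg_cone_def)
  ultimately obtain i where i: "0 < w $ i"
    by (metis vec_eq_iff zero_index)
  have "F w $ j = F w $ i / w $ i * w $ j" for j
  proof -
    consider "j = i" | "w $ j = 0" | "i \<noteq> j" "0 < w $ j"
      using w0[of j] by blast
    then show ?thesis
    proof cases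
      case 3
      then show ?thesis
        using ratio[OF w i 3(2,1)] ratio_eq[OF 3(1), of "w $ j / w $ i"] i by simp
    qed (use supp[OF w, of j] i in simp_all)
  qed
  then have "F w = (F w $ i / w $ i) *\<^sub>R w"
    unfolding vec_eq_iff vector_scaleR_component real_scaleR_def by blast
  then show ?thesis by blast
qed

end

text \<open>Meant for a point outside the simplex, with \<open>x\<close> its coordinates and
  \<open>v\<close> those of its image, confined to several lines through \<open>x\<close>. If
  \<open>v\<close> were not a multiple of \<open>x\<close>, every axis vector would lie in the span
  of \<open>x\<close> and \<open>1\<close>, against dimension at least 3.\<close>

lemma span_cap_trivial:
  fixes v x :: "real^'m"
  assumes card: "3 \<le> CARD('m)"
    and v1: "v \<in> span {x, 1}" and v2: "\<And>j. v \<in> span {x, 1 + axis j 1}"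
  shows "v \<in> span {x}"
proof (rule ccontr)
  assume nv: "v \<notin> span {x}"
  have "axis j 1 \<in> span {x, 1}" for j
  proof -
    obtain b where b: "v - b *\<^sub>R x \<in> span {1 + axis j 1}"
      using v2[of j] by (auto simp: span_insert)
    then obtain d where d: "v - b *\<^sub>R x = d *\<^sub>R (1 + axis j 1)"
      by (auto simp: span_singleton)
    have "d \<noteq> 0" using d nv by (auto simp: span_singleton)
    then have "axis j 1 = (1 / d) *\<^sub>R (v - b *\<^sub>R x) - 1"
      by (simp add: d)
    also have "\<dots> \<in> span {x, 1}"
      by (intro span_diff span_scale v1 span_base) auto
    finally show ?thesis .
  qed
  then have "(Basis :: (real^'m) set) \<subseteq> span {x, 1}"
    by (auto simp: Basis_vec_def)
  then have "span {x, 1} = (UNIV :: (real^'m) set)"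
    by (metis span_Basis span_mono span_span top.extremum_unique)
  then have "CARD('m) \<le> card {x, 1}"
    using dim_le_card[of UNIV "{x, 1}"] by simp
  also have "\<dots> \<le> 2" by (simp add: card_insert_if)
  finally show False using card by simp
qed

section \<open>Homogeneous coordinates\<close>

lemma homogenize_None [simp]: "homogenize x $ None = 1"
  and homogenize_Some [simp]: "homogenize x $ Some j = x $ j"
  by (simp_all add: homogenize_def)

lemma homogenize_nonzero [simp]: "homogenize x \<noteq> 0"
  by (metis homogenize_None zero_index zero_neq_one)

lemma homogenize_inject [simp]: "homogenize x = homogenize y \<longleftrightarrow> x = y"
  by (metis homogenize_Some vec_eq_iff)

lemma vec_option_eq_iff:
  fixes v w :: "real^('n::finite option)"
  shows "v = w \<longleftrightarrow> v $ None = w $ None \<and> (\<forall>j. v $ Some j = w $ Some j)"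
  unfolding vec_eq_iff by (metis option.exhaust)

lemma homogenize_sum:
  assumes "sum u I = 1"
  shows "homogenize (\<Sum>i\<in>I. u i *\<^sub>R p i) = (\<Sum>i\<in>I. u i *\<^sub>R homogenize (p i))"
  using assms by (simp add: vec_option_eq_iff)

lemma homogenize_convex:
  "homogenize ((1 - t) *\<^sub>R a + t *\<^sub>R b) = (1 - t) *\<^sub>R homogenize a + t *\<^sub>R homogenize b"
  by (simp add: vec_option_eq_iff)

lemma in_segment_homogenize:
  "x \<in> closed_segment a b \<longleftrightarrow>
     (\<exists>t. 0 \<le> t \<and> t \<le> 1 \<and> homogenize x = (1 - t) *\<^sub>R homogenize a + t *\<^sub>R homogenize b)"
  by (simp add: in_segment flip: homogenize_convex)

text \<open>Comparing \<open>None\<close> coordinates forces the weights to sum to 1, so this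
  condition stays implicit. Weights on the whole index type that vanish off \<open>J\<close> let
  faces be described by zero coordinates.\<close>

lemma convex_hull_image_homogenize:
  fixes p :: "'m::finite \<Rightarrow> real^'n"
  shows "x \<in> convex hull (p ` J) \<longleftrightarrow>
    (\<exists>w::real^'m. (\<forall>i. 0 \<le> w $ i) \<and> (\<forall>i. i \<notin> J \<longrightarrow> w $ i = 0) \<and>
       homogenize x = (\<Sum>i\<in>UNIV. w $ i *\<^sub>R homogenize (p i)))" (is "_ \<longleftrightarrow> (\<exists>w. ?R w x)")
proof
  have "convex {x. \<exists>w. ?R w x}"
  proof (rule convexI, clarify)
    fix x y :: "real^'n" and a b :: real and w v :: "real^'m"
    assume ab: "0 \<le> a" "0 \<le> b" "a + b = 1"
      and w: "\<forall>i. 0 \<le> w $ i" "\<forall>i. i \<notin> J \<longrightarrow> w $ i = 0"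
        "homogenize x = (\<Sum>i\<in>UNIV. w $ i *\<^sub>R homogenize (p i))"
      and v: "\<forall>i. 0 \<le> v $ i" "\<forall>i. i \<notin> J \<longrightarrow> v $ i = 0"
        "homogenize y = (\<Sum>i\<in>UNIV. v $ i *\<^sub>R homogenize (p i))"
    have a: "a = 1 - b" using ab by simp
    have "homogenize (a *\<^sub>R x + b *\<^sub>R y) = a *\<^sub>R homogenize x + b *\<^sub>R homogenize y"
      unfolding a by (rule homogenize_convex)
    also have "\<dots> = (\<Sum>i\<in>UNIV. (a *\<^sub>R w + b *\<^sub>R v) $ i *\<^sub>R homogenize (p i))"
      unfolding w(3) v(3) by (simp add: scaleR_sum_right sum.distrib scaleR_add_left)
    finally have "?R (a *\<^sub>R w + b *\<^sub>R v) (a *\<^sub>R x + b *\<^sub>R y)"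
      using ab w v by simp
    then show "\<exists>w. ?R w (a *\<^sub>R x + b *\<^sub>R y)" by blast
  qed
  moreover have "?R (axis j 1) (p j)" if "j \<in> J" for j
    using that by (auto simp: axis_def if_distrib[of "\<lambda>c. c *\<^sub>R _"] cong: if_cong)
  ultimately have "convex hull (p ` J) \<subseteq> {x. \<exists>w. ?R w x}"
    by (intro hull_minimal) blast+
  then show "x \<in> convex hull (p ` J) \<Longrightarrow> \<exists>w. ?R w x" by blast
next
  assume "\<exists>w. ?R w x"
  then obtain w where w: "?R w x" by blast
  have J: "(\<Sum>i\<in>UNIV. w $ i *\<^sub>R homogenize (p i)) = (\<Sum>i\<in>J. w $ i *\<^sub>R homogenize (p i))"
    using w by (intro sum.mono_neutral_right) auto
  have "sum (($) w) J = 1"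
    using arg_cong[of _ _ "\<lambda>v. v $ None", OF conjunct2[OF conjunct2[OF w], unfolded J]] by simp
  moreover from this have "x = (\<Sum>i\<in>J. w $ i *\<^sub>R p i)"
    using w J homogenize_sum[of "($) w" J p] by (metis homogenize_inject)
  ultimately show "x \<in> convex hull (p ` J)"
    using w by (simp add: convex_sum hull_inc)
qed

section \<open>Simplices and barycentric coordinates\<close>

text \<open>The columns are the homogenized vertices, so invertibility expresses affine independence
  of the points \<open>p i\<close>.\<close>

definition frame :: "('n option \<Rightarrow> real^'n) \<Rightarrow> real^('n::finite option)^('n option)" where
  "frame p = (\<chi> a i. homogenize (p i) $ a)"

definition coords :: "('n option \<Rightarrow> real^'n) \<Rightarrow> real^'n \<Rightarrow> real^('n::finite option)" where
  "coords p x = matrix_inv (frame p) *v homogenize x"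

lemma frame_mult: "frame p *v w = (\<Sum>i\<in>UNIV. w $ i *\<^sub>R homogenize (p i))"
  by (simp add: vec_eq_iff frame_def matrix_vector_mult_def mult.commute)

lemma invertible_iff_ker:
  fixes A :: "real^'m^'m"
  shows "invertible A \<longleftrightarrow> (\<forall>v. A *v v = 0 \<longrightarrow> v = 0)"
  by (simp add: invertible_left_inverse matrix_left_invertible_ker)

lemma matrix_inv_mult:
  fixes A :: "real^'m^'m"
  assumes "invertible A"
  shows "A ** matrix_inv A = mat 1" "matrix_inv A ** A = mat 1"
  using someI_ex[OF assms[unfolded invertible_def]] by (simp_all add: matrix_inv_def)

lemma invertible_matrix_inv:
  fixes A :: "real^'m^'m"
  shows "invertible A \<Longrightarrow> invertible (matrix_inv A)"
  using matrix_inv_mult[of A] unfolding invertible_def by blast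

lemma invertible_inv_vector:
  fixes A :: "real^'m^'m"
  assumes "invertible A"
  shows "A *v (matrix_inv A *v v) = v" "matrix_inv A *v (A *v v) = v"
  using matrix_inv_mult[OF assms] by (simp_all add: matrix_vector_mul_assoc)

lemma frame_coords: "invertible (frame p) \<Longrightarrow> frame p *v coords p x = homogenize x"
  by (simp add: coords_def invertible_inv_vector)

lemma coords_eqI: "invertible (frame p) \<Longrightarrow> homogenize x = frame p *v w \<Longrightarrow> coords p x = w"
  by (simp add: coords_def invertible_inv_vector)

lemma coords_convex:
  "homogenize x = (1 - t) *\<^sub>R homogenize a + t *\<^sub>R homogenize b \<Longrightarrow>
   coords p x = (1 - t) *\<^sub>R coords p a + t *\<^sub>R coords p b"
  by (simp add: coords_def matrix_vector_right_distrib matrix_vector_mult_scaleR)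

lemma hull_frame:
  "x \<in> convex hull (p ` J) \<longleftrightarrow>
    (\<exists>w. (\<forall>i. 0 \<le> w $ i) \<and> (\<forall>i. i \<notin> J \<longrightarrow> w $ i = 0) \<and> homogenize x = frame p *v w)"
  unfolding convex_hull_image_homogenize frame_mult ..

lemma hull_coords:
  assumes "invertible (frame p)"
  shows "x \<in> convex hull (p ` J) \<longleftrightarrow>
    (\<forall>i. 0 \<le> coords p x $ i) \<and> (\<forall>i. i \<notin> J \<longrightarrow> coords p x $ i = 0)"
  unfolding hull_frame
  using frame_coords[OF assms, of x] coords_eqI[OF assms, of x] by metis

lemma homogenize_eq_scaleR:
  assumes "homogenize x = a *\<^sub>R homogenize y"
  shows "x = y"
proof -
  have "a = 1" using arg_cong[OF assms, of "\<lambda>v. v $ None"] by simp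
  with assms show ?thesis by simp
qed

lemma exists_frame:
  fixes S :: "(real^'n) set"
  assumes "interior S \<noteq> {}"
  obtains p where "invertible (frame p)" "range p \<subseteq> S"
proof -
  from assms obtain x where "x \<in> interior S" by blast
  then obtain r where r: "0 < r" "cball x r \<subseteq> S" by (auto simp: mem_interior_cball)
  \<comment> \<open>A corner in the interior of \<open>S\<close>, and one further vertex at distance
    \<open>r\<close> from it along each axis.\<close>
  define p where "p i = (case i of None \<Rightarrow> x | Some j \<Rightarrow> x + r *\<^sub>R axis j 1)" for i
  have "w = 0" if w: "frame p *v w = 0" for w
  proof -
    have s: "(\<Sum>i\<in>UNIV. w $ i) = 0"
      using arg_cong[OF w, of "\<lambda>v. v $ None"] by (simp add: frame_mult)
    have "w $ Some j = 0" for j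
    proof -
      have "0 = (\<Sum>i\<in>UNIV. w $ i * p i $ j)"
        using arg_cong[OF w, of "\<lambda>v. v $ Some j"] by (simp add: frame_mult)
      \<comment> \<open>Every vertex has \<open>j\<close>-th coordinate \<open>x $ j\<close> except
        vertex \<open>Some j\<close>, which has \<open>r\<close> more. As the weights sum to 0, only
        this excess survives.\<close>
      also have "\<dots> = (\<Sum>i\<in>UNIV. w $ i * x $ j + (if i = Some j then r * w $ i else 0))"
        by (intro sum.cong) (auto simp: p_def axis_def algebra_simps split: option.split)
      also have "\<dots> = r * w $ Some j"
        using s by (simp add: sum.distrib flip: sum_distrib_right)
      finally show ?thesis using r by simp
    qed
    moreover from this s have "w $ None = 0"
      by (simp add: UNIV_option_conv sum.reindex)
    ultimately show "w = 0" by (simp add: vec_option_eq_iff)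
  qed
  then have "invertible (frame p)" by (simp add: invertible_iff_ker)
  moreover have "range p \<subseteq> cball x r"
    using r by (auto simp: p_def dist_norm norm_minus_commute split: option.split)
  ultimately show ?thesis using that r by blast
qed

section \<open>Betweenness isomorphisms are projective\<close>

locale betweenness_iso =
  fixes K K' :: "(real^'n) set" and f :: "real^'n \<Rightarrow> real^'n"
  assumes convex: "convex K" "convex K'"
    and bij: "bij_betw f K K'"
    and bet: "\<And>a x b. a \<in> K \<Longrightarrow> x \<in> K \<Longrightarrow> b \<in> K \<Longrightarrow>
                x \<in> closed_segment a b \<longleftrightarrow> f x \<in> closed_segment (f a) (f b)"
begin

lemma inj: "inj_on f K" and image: "f ` K = K'"
  using bij by (auto simp: bij_betw_def)

text \<open>Both inclusions use minimality of hulls: the image of a hull is convex since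
  \<open>f\<close> maps onto the convex set \<open>K'\<close> and reflects betweenness; the preimage
  of a hull is convex since \<open>f\<close> preserves betweenness.\<close>

lemma convex_hull_image:
  assumes S: "S \<subseteq> K"
  shows "convex hull (f ` S) = f ` (convex hull S)"
proof
  have hull: "convex hull S \<subseteq> K" "convex hull (f ` S) \<subseteq> K'"
    using hull_minimal[of S K convex] hull_minimal[of "f ` S" K' convex] S convex image by blast+
  have "convex (f ` (convex hull S))"
  proof (rule convex_contains_segment[THEN iffD2], intro ballI subsetI)
    fix a' b' y assume "a' \<in> f ` (convex hull S)" "b' \<in> f ` (convex hull S)"
      and "y \<in> closed_segment a' b'"
    then obtain a b where a: "a \<in> convex hull S" and b: "b \<in> convex hull S"
      and y: "y \<in> closed_segment (f a) (f b)" by blast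
    have "closed_segment (f a) (f b) \<subseteq> K'"
      using a b hull image convex(2) by (intro closed_segment_subset) auto
    with y obtain x where x: "x \<in> K" "y = f x" using image by blast
    then have "x \<in> closed_segment a b"
      using bet[of a x b] a b y hull by blast
    then have "x \<in> convex hull S"
      using closed_segment_subset[OF a b] by auto
    then show "y \<in> f ` (convex hull S)" using x by blast
  qed
  moreover have "f ` S \<subseteq> f ` (convex hull S)"
    by (intro image_mono hull_subset)
  ultimately show "convex hull (f ` S) \<subseteq> f ` (convex hull S)"
    by (intro hull_minimal)
  have "convex {x \<in> K. f x \<in> convex hull (f ` S)}"
  proof (rule convex_contains_segment[THEN iffD2], clarify)
    fix a b x assume a: "a \<in> K" "f a \<in> convex hull (f ` S)"
      and b: "b \<in> K" "f b \<in> convex hull (f ` S)"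
      and x: "x \<in> closed_segment a b"
    have "x \<in> K" using closed_segment_subset[OF a(1) b(1) convex(1)] x by blast
    moreover from this have "f x \<in> closed_segment (f a) (f b)"
      using bet a(1) b(1) x by blast
    then have "f x \<in> convex hull (f ` S)"
      using closed_segment_subset[OF a(2) b(2)] by auto
    ultimately show "x \<in> K \<and> f x \<in> convex hull (f ` S)" by blast
  qed
  moreover have "S \<subseteq> {x \<in> K. f x \<in> convex hull (f ` S)}"
    using S by (auto intro: hull_inc)
  ultimately have "convex hull S \<subseteq> {x \<in> K. f x \<in> convex hull (f ` S)}"
    by (intro hull_minimal)
  then show "f ` (convex hull S) \<subseteq> convex hull (f ` S)" by blast
qed

lemma mem_convex_hull_image:
  assumes S: "S \<subseteq> K" and x: "x \<in> K"
  shows "f x \<in> convex hull (f ` S) \<longleftrightarrow> x \<in> convex hull S"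
proof -
  have "convex hull S \<subseteq> K" using S convex(1) by (intro hull_minimal)
  then show ?thesis
    using inj_on_image_mem_iff[OF inj x] by (simp add: convex_hull_image[OF S])
qed

end

locale framed_betweenness_iso = betweenness_iso +
  fixes p :: "'n option \<Rightarrow> real^'n"
  assumes dim: "2 \<le> CARD('n)" and inv: "invertible (frame p)" and p: "range p \<subseteq> K"
begin

text \<open>A linear relation among the image vertices would give, by separating the signs as in Radon's
  theorem, a common point of two disjoint faces of the image simplex; \<open>f\<close> preserves disjoint faces.\<close>

lemma inv_image: "invertible (frame (f \<circ> p))"
  unfolding invertible_iff_ker
proof (intro allI impI)
  fix w assume w: "frame (f \<circ> p) *v w = 0"
  \<comment> \<open>The positive and negative parts of the relation have disjoint supports, and the
    \<open>None\<close> coordinate shows that they have the same total \<open>s\<close>.\<close>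
  define u where "u = (\<chi> i. max 0 (w $ i))"
  define v where "v = (\<chi> i. max 0 (- w $ i))"
  have "w = u - v" by (simp add: u_def v_def vec_eq_iff max_def)
  with w have uv: "frame (f \<circ> p) *v u = frame (f \<circ> p) *v v"
    by (simp add: matrix_vector_mult_diff_distrib)
  have nn: "0 \<le> u $ i" "0 \<le> v $ i" for i by (simp_all add: u_def v_def)
  define s where "s = (\<Sum>i\<in>UNIV. u $ i)"
  have sv: "s = (\<Sum>i\<in>UNIV. v $ i)"
    using arg_cong[OF uv, of "\<lambda>v. v $ None"] by (simp add: frame_mult s_def)
  have "s = 0"
  proof (rule ccontr)
    assume "s \<noteq> 0"
    then have s: "s > 0" using sum_nonneg[of UNIV "($) u"] nn by (simp add: s_def)
    define y where "y = (\<Sum>i\<in>UNIV. (u $ i / s) *\<^sub>R (f \<circ> p) i)"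
    have hy: "homogenize y = frame (f \<circ> p) *v ((1 / s) *\<^sub>R u)"
      unfolding y_def frame_mult using s
      by (subst homogenize_sum) (simp_all add: s_def flip: sum_divide_distrib)
    have hy': "homogenize y = frame (f \<circ> p) *v ((1 / s) *\<^sub>R v)"
      unfolding hy matrix_vector_mult_scaleR uv ..
    have "y \<in> convex hull ((f \<circ> p) ` {i. 0 < w $ i})"
      unfolding hull_frame
      using hy nn s by (intro exI[of _ "(1 / s) *\<^sub>R u"]) (auto simp: u_def)
    then obtain x where x: "y = f x" "x \<in> convex hull (p ` {i. 0 < w $ i})"
      using convex_hull_image[of "p ` {i. 0 < w $ i}"] p by (auto simp: image_comp)
    have "y \<in> convex hull ((f \<circ> p) ` {i. w $ i < 0})"
      unfolding hull_frame
      using hy' nn s by (intro exI[of _ "(1 / s) *\<^sub>R v"]) (auto simp: v_def)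
    then obtain x' where x': "y = f x'" "x' \<in> convex hull (p ` {i. w $ i < 0})"
      using convex_hull_image[of "p ` {i. w $ i < 0}"] p by (auto simp: image_comp)
    have "x \<in> K" "x' \<in> K"
      using x(2) x'(2) p convex(1) hull_minimal[of "p ` _" K convex] by blast+
    then have "x = x'" using inj_onD[OF inj, of x x'] x x' by simp
    \<comment> \<open>Each index lies outside at least one of the two faces that contain
      \<open>x\<close>.\<close>
    then have "coords p x $ i = 0" for i
      using x(2) x'(2) unfolding hull_coords[OF inv] by (cases "0 < w $ i") auto
    then have "coords p x = 0" by (simp add: vec_eq_iff)
    then show False using frame_coords[OF inv, of x] by (metis homogenize_nonzero matrix_vector_mult_0_right)
  qed
  then have "u $ i = 0" "v $ i = 0" for i
    using nn sv unfolding s_def by (simp_all add: sum_nonneg_eq_0_iff)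
  then show "w = 0" using \<open>w = u - v\<close> by (simp add: vec_eq_iff)
qed

section \<open>The map \<open>f\<close> in barycentric coordinates\<close>

text \<open>On the nonnegative cone this inverts \<open>coords p\<close> up to a positive factor:
  \<open>w\<close> is read as homogeneous barycentric coordinates.\<close>

definition point :: "real^('n option) \<Rightarrow> real^'n" where
  "point w = (\<Sum>i\<in>UNIV. (w $ i / (\<Sum>i\<in>UNIV. w $ i)) *\<^sub>R p i)"

text \<open>\<open>point 1\<close> is the barycentre. Its image need not be the barycentre of the
  image simplex, and these weights record the discrepancy.\<close>

definition weight :: "real^('n option)" where
  "weight = coords (f \<circ> p) (f (point 1))"

text \<open>Coordinates of the image rescaled so that the barycentre keeps the coordinates of \<open>1\<close>.\<close>

definition image_coords :: "real^'n \<Rightarrow> real^('n option)" where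
  "image_coords x = (\<chi> i. coords (f \<circ> p) (f x) $ i / weight $ i)"

lemma sum_pos_cone: "w \<in> nonneg_cone \<Longrightarrow> 0 < (\<Sum>i\<in>UNIV. w $ i)"
  using sum_nonneg[of UNIV "($) w"] sum_nonneg_eq_0_iff[of UNIV "($) w"]
  by (auto simp: nonneg_cone_def vec_eq_iff order_le_less)

lemma homogenize_point:
  assumes "w \<in> nonneg_cone"
  shows "homogenize (point w) = (1 / (\<Sum>i\<in>UNIV. w $ i)) *\<^sub>R (frame p *v w)"
  unfolding point_def frame_mult using sum_pos_cone[OF assms]
  by (subst homogenize_sum) (simp_all add: scaleR_sum_right flip: sum_divide_distrib)

lemma coords_point:
  assumes "w \<in> nonneg_cone"
  shows "coords p (point w) = (1 / (\<Sum>i\<in>UNIV. w $ i)) *\<^sub>R w"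
  using homogenize_point[OF assms] by (intro coords_eqI inv) (simp add: matrix_vector_mult_scaleR)

lemma point_coords:
  assumes "coords p x \<in> nonneg_cone"
  shows "point (coords p x) = x"
  using homogenize_point[OF assms] frame_coords[OF inv, of x] by (metis homogenize_eq_scaleR)

lemma coords_nonzero: "coords p x \<noteq> 0"
  using frame_coords[OF inv, of x] by (metis homogenize_nonzero matrix_vector_mult_0_right)

lemma point_in_K:
  assumes "w \<in> nonneg_cone"
  shows "point w \<in> K"
proof -
  have "point w \<in> convex hull (range p)"
    unfolding hull_coords[OF inv] coords_point[OF assms]
    using assms sum_pos_cone[OF assms] by (auto simp: nonneg_cone_def)
  then show ?thesis using p convex(1) hull_minimal[of "range p" K convex] by blast
qed

lemma coords_image_face:
  assumes x: "x \<in> K"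
  shows "(\<forall>i. 0 \<le> coords (f \<circ> p) (f x) $ i) \<and> (\<forall>i. i \<notin> J \<longrightarrow> coords (f \<circ> p) (f x) $ i = 0) \<longleftrightarrow>
         (\<forall>i. 0 \<le> coords p x $ i) \<and> (\<forall>i. i \<notin> J \<longrightarrow> coords p x $ i = 0)"
  unfolding hull_coords[OF inv, symmetric] hull_coords[OF inv_image, symmetric]
  using mem_convex_hull_image[OF _ x, of "p ` J"] p by (auto simp: image_comp)

lemma coords_image_nonneg:
  assumes x: "x \<in> K" and "\<forall>i. 0 \<le> coords p x $ i"
  shows "0 \<le> coords (f \<circ> p) (f x) $ i" "coords (f \<circ> p) (f x) $ i = 0 \<longleftrightarrow> coords p x $ i = 0"
  \<comment> \<open>The full simplex gives the signs, the facet opposite vertex \<open>i\<close> the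
    vanishing of coordinate \<open>i\<close>.\<close>
  using coords_image_face[OF x, of UNIV] coords_image_face[OF x, of "- {i}"] assms(2) by auto

lemma weight_pos: "0 < weight $ i"
  using coords_image_nonneg[OF point_in_K[OF one_in_nonneg_cone], of i]
  by (simp add: weight_def coords_point[OF one_in_nonneg_cone] order_le_less)

text \<open>The rescaling is linear and so keeps convex combinations. The last property, from
  injectivity, allows solving for \<open>image_coords b\<close> when \<open>x\<close> differs from
  \<open>a\<close>.\<close>

lemma image_coords_convex:
  assumes "a \<in> K" "x \<in> K" "b \<in> K" "x \<in> closed_segment a b"
  obtains t where "0 \<le> t" "t \<le> 1" "image_coords x = (1 - t) *\<^sub>R image_coords a + t *\<^sub>R image_coords b"
    "t = 0 \<Longrightarrow> x = a"
proof -
  have "f x \<in> closed_segment (f a) (f b)" using bet assms by blast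
  then obtain t where t: "0 \<le> t" "t \<le> 1"
    "homogenize (f x) = (1 - t) *\<^sub>R homogenize (f a) + t *\<^sub>R homogenize (f b)"
    unfolding in_segment_homogenize by blast
  from coords_convex[OF t(3), of "f \<circ> p"]
  have "image_coords x = (1 - t) *\<^sub>R image_coords a + t *\<^sub>R image_coords b"
    by (simp add: image_coords_def vec_eq_iff add_divide_distrib)
  moreover have "x = a" if "t = 0"
    using t(3) that inj_onD[OF inj, of x a] assms by simp
  ultimately show ?thesis using that t by blast
qed

lemma point_add:
  assumes u: "u \<in> nonneg_cone" and v: "v \<in> nonneg_cone"
  shows "point (u + v) \<in> closed_segment (point u) (point v)"
proof -
  define a b where "a = (\<Sum>i\<in>UNIV. u $ i)" and "b = (\<Sum>i\<in>UNIV. v $ i)"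
  have ab: "0 < a" "0 < b" using sum_pos_cone u v by (auto simp: a_def b_def)
  have s: "(\<Sum>i\<in>UNIV. (u + v) $ i) = a + b" by (simp add: a_def b_def sum.distrib)
  have "homogenize (point (u + v)) = (1 - b / (a + b)) *\<^sub>R homogenize (point u)
      + (b / (a + b)) *\<^sub>R homogenize (point v)"
    unfolding homogenize_point[OF u] homogenize_point[OF v]
      homogenize_point[OF nonneg_cone_add[OF u v]] s a_def[symmetric] b_def[symmetric]
    using ab by (simp add: matrix_vector_right_distrib scaleR_add_right field_simps)
  then show ?thesis
    unfolding in_segment_homogenize using ab by (intro exI[of _ "b / (a + b)"]) auto
qed

text \<open>Preservation of segments gives \<open>add\<close>, preservation of faces gives
  \<open>supp\<close>, and division by \<open>weight\<close> gives \<open>one\<close>.\<close>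

interpretation F: cone_map "\<lambda>w. image_coords (point w)"
proof
  show "3 \<le> CARD('n option)" using dim by simp
  fix w :: "real^('n option)" assume w: "w \<in> nonneg_cone"
  show "image_coords (point (c *\<^sub>R w)) = image_coords (point w)" if "0 < c" for c
  proof -
    have "point (c *\<^sub>R w) = point w"
      using that unfolding point_def by (simp flip: sum_distrib_left)
    then show ?thesis by simp
  qed
  have nn: "\<forall>i. 0 \<le> coords p (point w) $ i"
    using w sum_pos_cone[OF w] by (auto simp: coords_point nonneg_cone_def)
  fix i
  show "0 \<le> image_coords (point w) $ i"
    using coords_image_nonneg(1)[OF point_in_K[OF w] nn] weight_pos[of i]
    by (simp add: image_coords_def)
  have "w $ i = 0 \<longleftrightarrow> coords p (point w) $ i = 0"
    using sum_pos_cone[OF w] by (simp add: coords_point[OF w])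
  then show "image_coords (point w) $ i = 0 \<longleftrightarrow> w $ i = 0"
    using coords_image_nonneg(2)[OF point_in_K[OF w] nn] weight_pos[of i]
    by (simp add: image_coords_def)
next
  fix u v :: "real^('n option)" assume uv: "u \<in> nonneg_cone" "v \<in> nonneg_cone"
  show "\<exists>a b. 0 \<le> a \<and> 0 \<le> b \<and> image_coords (point (u + v))
      = a *\<^sub>R image_coords (point u) + b *\<^sub>R image_coords (point v)"
    using image_coords_convex[OF _ _ _ point_add[OF uv]] uv
    by (metis diff_ge_0_iff_ge nonneg_cone_add point_in_K)
next
  fix i j
  show "image_coords (point 1) $ i = image_coords (point 1) $ j"
    using weight_pos[of i] weight_pos[of j] by (simp add: image_coords_def flip: weight_def)
qed

section \<open>From the simplex to all of \<open>K\<close>\<close>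

lemma proportional_simplex:
  assumes "\<forall>i. 0 \<le> coords p x $ i"
  shows "\<exists>c. image_coords x = c *\<^sub>R coords p x"
proof -
  have "coords p x \<in> nonneg_cone" using assms coords_nonzero by (simp add: nonneg_cone_def)
  then show ?thesis using F.proportional[of "coords p x"] by (simp add: point_coords)
qed

text \<open>The line from \<open>x\<close> to an interior point of the simplex starts with a segment inside the simplex,
  where \<open>f\<close> is already known to be projective.\<close>

lemma image_coords_in_span:
  assumes x: "x \<in> K" "\<not> (\<forall>i. 0 \<le> coords p x $ i)" and w: "\<forall>i. 0 < w $ i"
  shows "image_coords x \<in> span {coords p x, w}"
proof -
  have wC: "w \<in> nonneg_cone" using w by (intro nonneg_coneI) (auto simp: less_imp_le less_imp_neq[symmetric])
  define y where "y = point w"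
  define s where "s = (\<Sum>i\<in>UNIV. w $ i)"
  have s: "0 < s" using sum_pos_cone[OF wC] by (simp add: s_def)
  have y: "y \<in> K" and cy: "coords p y = (1 / s) *\<^sub>R w"
    unfolding y_def s_def using point_in_K coords_point wC by auto
  have y0: "0 < coords p y $ i" for i using w s by (simp add: cy)
  \<comment> \<open>The coordinates of \<open>y\<close> are positive, so by continuity those of a
    point slightly moved towards \<open>x\<close> stay nonnegative.\<close>
  obtain t where t: "0 < t" "t < 1" and tc: "\<And>i. 0 \<le> ((1 - t) *\<^sub>R coords p y + t *\<^sub>R coords p x) $ i"
  proof -
    have "\<forall>\<^sub>F t in at_right 0. \<forall>i. 0 < (1 - t) * coords p y $ i + t * coords p x $ i"
    proof (intro eventually_all_finite order_tendstoD(1))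
      fix i
      show "((\<lambda>t. (1 - t) * coords p y $ i + t * coords p x $ i)
          \<longlongrightarrow> (1 - 0) * coords p y $ i + 0 * coords p x $ i) (at_right 0)"
        by (intro tendsto_intros)
    qed (use y0 in simp)
    moreover have "\<forall>\<^sub>F t in at_right 0. 0 < t \<and> t < (1::real)"
      by (auto simp: eventually_at_right_field intro!: exI[of _ 1])
    ultimately have "\<forall>\<^sub>F t in at_right 0. (0 < t \<and> t < 1) \<and>
        (\<forall>i. 0 < (1 - t) * coords p y $ i + t * coords p x $ i)"
      by (rule eventually_elim2) simp
    from eventually_happens[OF this] show ?thesis
      using that by (auto intro: less_imp_le)
  qed
  define z where "z = (1 - t) *\<^sub>R y + t *\<^sub>R x"
  have zs: "z \<in> closed_segment y x" unfolding z_def in_segment using t by (intro exI[of _ t]) simp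
  then have z: "z \<in> K" using closed_segment_subset[OF y x(1) convex(1)] by blast
  have cz: "coords p z = (1 - t) *\<^sub>R coords p y + t *\<^sub>R coords p x"
    unfolding z_def by (intro coords_convex homogenize_convex)
  have zy: "z \<noteq> y"
  proof
    assume "z = y"
    then have "t *\<^sub>R x = t *\<^sub>R y" unfolding z_def by (simp add: algebra_simps)
    then have "x = y" using t by simp
    then show False using x y0 by (simp add: less_imp_le)
  qed
  obtain a where a: "image_coords z = a *\<^sub>R coords p z"
    using proportional_simplex[of z] tc unfolding cz by blast
  obtain b where b: "image_coords y = b *\<^sub>R coords p y"
    using proportional_simplex[of y] y0 by (meson less_imp_le)
  \<comment> \<open>As \<open>z\<close> differs from \<open>y\<close>, the factor \<open>r\<close>
    is nonzero and the equation can be solved for the image of \<open>x\<close>.\<close>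
  obtain r where r: "image_coords z = (1 - r) *\<^sub>R image_coords y + r *\<^sub>R image_coords x" "r \<noteq> 0"
    using image_coords_convex[OF y z x(1) zs] zy by metis
  then have "image_coords x = (1 / r) *\<^sub>R (image_coords z - (1 - r) *\<^sub>R image_coords y)"
    by simp
  also have "\<dots> \<in> span {coords p x, w}"
    unfolding a b cz cy by (intro span_scale span_diff span_add span_base) auto
  finally show ?thesis .
qed

text \<open>Outside the simplex, the lines from \<open>x\<close> to the interior points with weights
  \<open>1\<close> and \<open>1 + axis j 1\<close> together have only \<open>x\<close> in common.
  Each of them confines \<open>image_coords x\<close> to a span.\<close>

lemma proportional:
  assumes x: "x \<in> K"
  shows "\<exists>c. image_coords x = c *\<^sub>R coords p x"
proof (cases "\<forall>i. 0 \<le> coords p x $ i")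
  case False
  have "image_coords x \<in> span {coords p x}"
  proof (rule span_cap_trivial)
    show "3 \<le> CARD('n option)" using dim by simp
  qed (rule image_coords_in_span[OF x False]; simp add: axis_def)+
  then show ?thesis by (auto simp: span_singleton)
qed (rule proportional_simplex)

text \<open>The matrix passes to coordinates in the simplex, rescales them by \<open>weight\<close>,
  and reads the result in the image simplex. The nonzero factor says that \<open>x\<close> is not
  sent to infinity.\<close>

theorem projective:
  obtains A where "invertible A"
    "\<And>x. x \<in> K \<Longrightarrow> \<exists>c. c \<noteq> 0 \<and> A *v homogenize x = c *\<^sub>R homogenize (f x)"
proof
  define D :: "real^('n option)^('n option)" where "D = (\<chi> i j. if i = j then weight $ i else 0)"
  have D: "D *v v = (\<chi> i. weight $ i * v $ i)" for v
    by (simp add: D_def matrix_vector_mult_def vec_eq_iff if_distrib[of "\<lambda>c. c * _"] cong: if_cong)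
  have "invertible D"
    unfolding invertible_iff_ker D using weight_pos by (auto simp: vec_eq_iff less_imp_neq[symmetric])
  then show "invertible (frame (f \<circ> p) ** D ** matrix_inv (frame p))"
    by (intro invertible_mult inv inv_image invertible_matrix_inv)
  fix x assume x: "x \<in> K"
  obtain c where c: "image_coords x = c *\<^sub>R coords p x" using proportional[OF x] by blast
  have "D *v image_coords x = coords (f \<circ> p) (f x)"
    unfolding D using weight_pos by (simp add: image_coords_def vec_eq_iff less_imp_neq[symmetric])
  then have 1: "homogenize (f x) = c *\<^sub>R (frame (f \<circ> p) *v (D *v coords p x))"
    using frame_coords[OF inv_image, of "f x"] unfolding c matrix_vector_mult_scaleR
    by (metis matrix_vector_mult_scaleR)
  then have "c \<noteq> 0" by (metis homogenize_nonzero scaleR_zero_left)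
  with 1 have "(frame (f \<circ> p) ** D ** matrix_inv (frame p)) *v homogenize x
      = (1 / c) *\<^sub>R homogenize (f x)"
    by (simp add: coords_def flip: matrix_vector_mul_assoc)
  then show "\<exists>c. c \<noteq> 0 \<and> (frame (f \<circ> p) ** D ** matrix_inv (frame p)) *v homogenize x
      = c *\<^sub>R homogenize (f x)"
    using \<open>c \<noteq> 0\<close> by (intro exI[of _ "1 / c"]) simp
qed

end

section \<open>Projective maps preserve betweenness\<close>

text \<open>The denominator \<open>l\<close> of the projective map is affine along the segment and
  nowhere zero on \<open>K\<close>, so it keeps its sign there. This makes the weights
  \<open>q\<close> and \<open>r\<close> of the image point nonnegative.\<close>

lemma projective_segment:
  assumes K: "convex K"
    and f: "\<And>x. x \<in> K \<Longrightarrow> \<exists>c. c \<noteq> 0 \<and> A *v homogenize x = c *\<^sub>R homogenize (f x)"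
    and a: "a \<in> K" and b: "b \<in> K" and x: "x \<in> closed_segment a b"
  shows "f x \<in> closed_segment (f a) (f b)"
proof -
  define l where "l y = (A *v homogenize y) $ None" for y
  have l: "A *v homogenize y = l y *\<^sub>R homogenize (f y)" and l0: "l y \<noteq> 0" if y: "y \<in> K" for y
  proof -
    obtain c where "c \<noteq> 0" "A *v homogenize y = c *\<^sub>R homogenize (f y)"
      using f[OF y] by blast
    then show "A *v homogenize y = l y *\<^sub>R homogenize (f y)" "l y \<noteq> 0"
      by (simp_all add: l_def)
  qed
  have seg: "y \<in> K" if "y \<in> closed_segment a b" for y
    using closed_segment_subset[OF a b K] that by blast
  have A: "A *v homogenize ((1 - t) *\<^sub>R a + t *\<^sub>R b)
      = ((1 - t) * l a) *\<^sub>R homogenize (f a) + (t * l b) *\<^sub>R homogenize (f b)" for t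
    by (simp add: homogenize_convex matrix_vector_right_distrib matrix_vector_mult_scaleR l a b)
  have lt: "l ((1 - t) *\<^sub>R a + t *\<^sub>R b) = (1 - t) * l a + t * l b" for t
    using A[of t] by (simp add: l_def[of "(1 - t) *\<^sub>R a + t *\<^sub>R b"])
  have sign: "0 < l a * l b"
  proof (rule ccontr)
    assume "\<not> 0 < l a * l b"
    then have "l a * l b < 0" using l0[OF a] l0[OF b] by (simp add: not_less order_le_less)
    \<comment> \<open>The zero of \<open>(1 - t) * l a + t * l b\<close>; it falls into the unit
      interval because \<open>l a\<close> and \<open>l b\<close> have opposite signs.\<close>
    define t where "t = l a / (l a - l b)"
    have "t * (l a - l b) = l a"
      using \<open>l a * l b < 0\<close> by (auto simp: t_def mult_less_0_iff)
    then have "(1 - t) * l a + t * l b = 0" by (simp add: algebra_simps)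
    moreover have "0 \<le> t" "t \<le> 1"
      using \<open>l a * l b < 0\<close>
      by (auto simp: t_def mult_less_0_iff zero_le_divide_iff divide_le_eq_1)
    ultimately have t: "0 \<le> t" "t \<le> 1" "(1 - t) * l a + t * l b = 0" by blast+
    then have "(1 - t) *\<^sub>R a + t *\<^sub>R b \<in> K"
      by (intro seg) (auto simp: in_segment)
    then show False using l0 lt t by metis
  qed
  obtain t where t: "0 \<le> t" "t \<le> 1" "x = (1 - t) *\<^sub>R a + t *\<^sub>R b"
    using x by (auto simp: in_segment)
  define m where "m = (1 - t) * l a + t * l b"
  define q r where "q = (1 - t) * l a / m" and "r = t * l b / m"
  have xK: "x \<in> K" using seg x .
  have m: "m \<noteq> 0" "l x = m" using l0[OF xK] lt[of t] t by (auto simp: m_def)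
  have "m *\<^sub>R homogenize (f x)
      = ((1 - t) * l a) *\<^sub>R homogenize (f a) + (t * l b) *\<^sub>R homogenize (f b)"
    using A[of t] l[OF xK] m t(3) by simp
  then have "(1 / m) *\<^sub>R (m *\<^sub>R homogenize (f x))
      = (1 / m) *\<^sub>R (((1 - t) * l a) *\<^sub>R homogenize (f a) + (t * l b) *\<^sub>R homogenize (f b))"
    by (rule arg_cong)
  then have eq: "homogenize (f x) = q *\<^sub>R homogenize (f a) + r *\<^sub>R homogenize (f b)"
    using m(1) by (simp add: scaleR_add_right q_def r_def)
  have "q + r = 1" using m(1) unfolding q_def r_def m_def by (simp flip: add_divide_distrib)
  moreover have "0 \<le> q \<and> 0 \<le> r"
  proof (cases "0 < l a")
    case True
    then have "0 < l b" using sign by (simp add: zero_less_mult_iff)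
    with True show ?thesis using t(1,2) by (simp add: q_def r_def m_def)
  next
    case False
    then have "l a < 0" "l b < 0" using sign by (auto simp: zero_less_mult_iff)
    then have n: "(1 - t) * l a \<le> 0" "t * l b \<le> 0" using t(1,2) by (simp_all add: mult_nonneg_nonpos)
    then have "m \<le> 0" unfolding m_def by simp
    with n show ?thesis unfolding q_def r_def by (simp add: divide_nonpos_nonpos)
  qed
  ultimately have "0 \<le> r" "r \<le> 1" "q = 1 - r" by linarith+
  then show ?thesis
    using eq unfolding in_segment_homogenize by blast
qed

section \<open>The action of projective transformations on the affine chart\<close>

lemma PGL_action_affine_chart:
  assumes "invertible A"
  shows "PGL_action (scalar_multiple_rel `` {A}) (affine_chart x) = span {A *v homogenize x}"
proof -
  have "PGL_action (scalar_multiple_rel `` {A}) (affine_chart x) = (*v) A ` span {homogenize x}"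
    unfolding affine_chart_def by (rule PGL_action_class[OF assms subspace_span])
  also have "\<dots> = span ((*v) A ` {homogenize x})"
    by (simp only: linear_span_image[OF matrix_vector_mul_linear])
  finally show ?thesis by simp
qed

lemma span_eq_affine_chart:
  "span {v} = affine_chart y \<longleftrightarrow> (\<exists>c. c \<noteq> 0 \<and> v = c *\<^sub>R homogenize y)"
proof
  assume eq: "span {v} = affine_chart y"
  then have "v \<in> span {homogenize y}" "homogenize y \<in> span {v}"
    unfolding affine_chart_def by (auto intro: span_base)
  then show "\<exists>c. c \<noteq> 0 \<and> v = c *\<^sub>R homogenize y"
    by (auto simp: span_singleton)
next
  assume "\<exists>c. c \<noteq> 0 \<and> v = c *\<^sub>R homogenize y"
  then obtain c where c: "c \<noteq> 0" "v = c *\<^sub>R homogenize y" by blast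
  then show "span {v} = affine_chart y"
    using span_image_scale[of "{homogenize y}" "\<lambda>_. c"] by (simp add: affine_chart_def)
qed

lemma PGL_action_eq_affine_chart:
  "invertible A \<Longrightarrow> PGL_action (scalar_multiple_rel `` {A}) (affine_chart x) = affine_chart y \<longleftrightarrow>
    (\<exists>c. c \<noteq> 0 \<and> A *v homogenize x = c *\<^sub>R homogenize y)"
  by (simp add: PGL_action_affine_chart span_eq_affine_chart)

lemma affine_chart_not_at_infinity: "affine_chart y \<notin> hyperplane_at_infinity"
proof -
  have "homogenize y \<in> affine_chart y" by (simp add: affine_chart_def span_base)
  then show ?thesis by (force simp: hyperplane_at_infinity_def)
qed

lemma LB_iso_segment_structure:
  "LB_iso f (segment_structure K) (segment_structure K') \<longleftrightarrow>
    bij_betw f K K' \<and>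
    (\<forall>a\<in>K. \<forall>x\<in>K. \<forall>b\<in>K. x \<in> closed_segment a b \<longleftrightarrow> f x \<in> closed_segment (f a) (f b))"
  by (simp add: LB_iso_def segment_structure_def)

text \<open>Points of \<open>K\<close> are sent to points of the affine chart, never to infinity, so
  none of them lies on the singular hyperplane.\<close>

lemma LB_iso_imp_projective:
  fixes K K' :: "(real^'n) set"
  assumes "CARD('n) \<ge> 2" and "convex K" and int: "interior K \<noteq> {}" and "convex K'"
    and iso: "LB_iso f (segment_structure K) (segment_structure K')"
  shows "\<exists>T \<in> PGL. singular_hyperplane T \<inter> affine_chart ` K = {} \<and>
           PGL_action T ` affine_chart ` K = affine_chart ` K' \<and>
           (\<forall>x\<in>K. PGL_action T (affine_chart x) = affine_chart (f x))"
proof -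
  obtain p where p: "invertible (frame p)" "range p \<subseteq> K"
    by (rule exists_frame[OF int])
  interpret framed_betweenness_iso K K' f p
    using assms p by unfold_locales (auto simp: LB_iso_segment_structure)
  obtain A where A: "invertible A"
    "\<And>x. x \<in> K \<Longrightarrow> \<exists>c. c \<noteq> 0 \<and> A *v homogenize x = c *\<^sub>R homogenize (f x)"
    using projective by blast
  let ?T = "scalar_multiple_rel `` {A}"
  have act: "PGL_action ?T (affine_chart x) = affine_chart (f x)" if "x \<in> K" for x
    using A(2)[OF that] by (simp add: PGL_action_eq_affine_chart[OF A(1)])
  have "?T \<in> PGL" unfolding PGL_def using A(1) by (auto intro: quotientI)
  moreover have "singular_hyperplane ?T \<inter> affine_chart ` K = {}"
    using act by (auto simp: singular_hyperplane_def affine_chart_not_at_infinity)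
  moreover have "PGL_action ?T ` affine_chart ` K = affine_chart ` K'"
    unfolding image[symmetric] image_image using act by (rule image_cong[OF refl])
  ultimately show ?thesis using act by blast
qed

text \<open>Betweenness is preserved by \<open>projective_segment\<close> for \<open>A\<close>, and
  reflected by the same lemma for \<open>matrix_inv A\<close> and the inverse of \<open>f\<close> on
  \<open>K'\<close>.\<close>

lemma projective_imp_LB_iso:
  assumes convex: "convex K" "convex K'" and T: "T \<in> PGL"
    and img: "PGL_action T ` affine_chart ` K = affine_chart ` K'"
    and act: "\<And>x. x \<in> K \<Longrightarrow> PGL_action T (affine_chart x) = affine_chart (f x)"
  shows "LB_iso f (segment_structure K) (segment_structure K')"
proof -
  obtain A where A: "invertible A" and TA: "T = scalar_multiple_rel `` {A}"
    using T unfolding PGL_def by (auto elim: quotientE)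
  have f: "\<exists>c. c \<noteq> 0 \<and> A *v homogenize x = c *\<^sub>R homogenize (f x)" if "x \<in> K" for x
    using act[OF that] by (simp add: TA PGL_action_eq_affine_chart[OF A])
  have inv: "\<exists>c. c \<noteq> 0 \<and> matrix_inv A *v homogenize (f x) = c *\<^sub>R homogenize x" if x: "x \<in> K" for x
  proof -
    obtain c where c: "c \<noteq> 0" "A *v homogenize x = c *\<^sub>R homogenize (f x)"
      using f[OF x] by blast
    then have "homogenize x = c *\<^sub>R (matrix_inv A *v homogenize (f x))"
      by (metis A invertible_inv_vector(2) matrix_vector_mult_scaleR)
    with c(1) show ?thesis by (intro exI[of _ "1 / c"]) simp
  qed
  have "inj_on f K"
  proof (rule inj_onI)
    fix x y assume "x \<in> K" "y \<in> K" "f x = f y"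
    then obtain c d where "c \<noteq> 0" "c *\<^sub>R homogenize x = d *\<^sub>R homogenize y"
      using inv[of x] inv[of y] by metis
    then have "homogenize x = (d / c) *\<^sub>R homogenize y"
      by (metis divide_inverse mult.commute scaleR_left_imp_eq scaleR_one scaleR_scaleR right_inverse)
    then show "x = y" by (rule homogenize_eq_scaleR)
  qed
  moreover have "affine_chart ` f ` K = affine_chart ` K'"
    unfolding img[symmetric] image_image using act by (intro image_cong) auto
  then have "f ` K = K'" by (simp add: inj_image_eq_iff[OF inj_affine_chart])
  ultimately have bij: "bij_betw f K K'" by (simp add: bij_betw_def)
  define g where "g = the_inv_into K f"
  have g: "g (f x) = x" if "x \<in> K" for x
    unfolding g_def using \<open>inj_on f K\<close> that by (rule the_inv_into_f_f)
  have "\<exists>c. c \<noteq> 0 \<and> matrix_inv A *v homogenize y = c *\<^sub>R homogenize (g y)" if "y \<in> K'" for y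
    using that inv g \<open>f ` K = K'\<close> by auto
  from projective_segment[OF convex(2) this]
  have "x \<in> closed_segment a b"
    if "a \<in> K" "x \<in> K" "b \<in> K" "f x \<in> closed_segment (f a) (f b)" for a x b
    using that g \<open>f ` K = K'\<close> by (metis imageI)
  then show ?thesis
    unfolding LB_iso_segment_structure using bij projective_segment[OF convex(1) f] by blast
qed

theorem theorem3p4:
  fixes K K' :: "(real^'n) set"
  assumes "CARD('n) \<ge> 2"
    and "convex K" and "interior K \<noteq> {}" and "open K \<or> closed K"
    and "convex K'" and "interior K' \<noteq> {}" and "open K' \<or> closed K'"
  shows "(\<forall>f. f ` K \<subseteq> K' \<longrightarrow>
            (LB_iso f (segment_structure K) (segment_structure K') \<longleftrightarrow>
             (\<exists>T \<in> PGL.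
                singular_hyperplane T \<inter> affine_chart ` K = {} \<and>
                PGL_action T ` affine_chart ` K = affine_chart ` K' \<and>
                (\<forall>x\<in>K. PGL_action T (affine_chart x) = affine_chart (f x)))))
       \<and> (LB_isomorphic (segment_structure K) (segment_structure K') \<longleftrightarrow>
            (\<exists>T \<in> PGL.
               singular_hyperplane T \<inter> affine_chart ` K = {} \<and>
               PGL_action T ` affine_chart ` K = affine_chart ` K'))"
proof (rule conjI, intro allI impI)
  note to_projective = LB_iso_imp_projective[OF assms(1-3,5)]
  note from_projective = projective_imp_LB_iso[OF assms(2,5)]
  show "LB_iso f (segment_structure K) (segment_structure K') \<longleftrightarrow>
      (\<exists>T \<in> PGL. singular_hyperplane T \<inter> affine_chart ` K = {} \<and>
         PGL_action T ` affine_chart ` K = affine_chart ` K' \<and>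
         (\<forall>x\<in>K. PGL_action T (affine_chart x) = affine_chart (f x)))" for f
  proof
    assume "\<exists>T \<in> PGL. singular_hyperplane T \<inter> affine_chart ` K = {} \<and>
         PGL_action T ` affine_chart ` K = affine_chart ` K' \<and>
         (\<forall>x\<in>K. PGL_action T (affine_chart x) = affine_chart (f x))"
    then show "LB_iso f (segment_structure K) (segment_structure K')"
      by (elim bexE conjE) (rule from_projective, auto)
  qed (rule to_projective)
  show "LB_isomorphic (segment_structure K) (segment_structure K') \<longleftrightarrow>
      (\<exists>T \<in> PGL. singular_hyperplane T \<inter> affine_chart ` K = {} \<and>
         PGL_action T ` affine_chart ` K = affine_chart ` K')"
  proof
    assume "LB_isomorphic (segment_structure K) (segment_structure K')"
    then obtain f where "LB_iso f (segment_structure K) (segment_structure K')"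
      by (auto simp: LB_isomorphic_def)
    from to_projective[OF this]
    show "\<exists>T \<in> PGL. singular_hyperplane T \<inter> affine_chart ` K = {} \<and>
         PGL_action T ` affine_chart ` K = affine_chart ` K'"
      by (elim bexE conjE) (intro bexI conjI)
  next
    assume "\<exists>T \<in> PGL. singular_hyperplane T \<inter> affine_chart ` K = {} \<and>
         PGL_action T ` affine_chart ` K = affine_chart ` K'"
    then obtain T where T: "T \<in> PGL" "PGL_action T ` affine_chart ` K = affine_chart ` K'"
      by (elim bexE conjE)
    \<comment> \<open>The transformation sends chart points of \<open>K\<close> to chart points, so
      choosing their affine preimages yields the map \<open>f\<close>.\<close>
    have "\<exists>y. PGL_action T (affine_chart x) = affine_chart y" if "x \<in> K" for x
      using T(2) that by (metis image_iff)
    then obtain f where f: "\<And>x. x \<in> K \<Longrightarrow> PGL_action T (affine_chart x) = affine_chart (f x)"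
      by metis
    have "LB_iso f (segment_structure K) (segment_structure K')"
      by (rule from_projective[OF T]) (rule f)
    then show "LB_isomorphic (segment_structure K) (segment_structure K')"
      unfolding LB_isomorphic_def by blast
  qed
qed

end
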